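(* Let $n \le \ell$ and $m$ be positive integers, and consider the controlled ODE (continuous-time recurrent neural network) $$\dot x = -\frac{1}{\tau} x + W\sigma_{\ell}(Ax + Bu + \mu) + \nu,$$ with state $x\in\mathbb{R}^n$, input $u\in\mathbb{R}^m$, scalar $\tau>0$, and parameters $W\in\mathbb{R}^{n\times\ell}$, $A\in\mathbb{R}^{\ell\times n}$, $B\in\mathbb{R}^{\ell\times m}$, $\mu\in\mathbb{R}^\ell$, $\nu\in\mathbb{R}^n$. Here $\sigma_\ell(w)=(\sigma(w_1),\dots,\sigma(w_\ell))^\top$, where $\sigma:\mathbb{R}\to\mathbb{R}$ is strictly increasing, continuous, subdifferentiable, satisfies $\sigma(0)=0$ and the slope condition $0\le \frac{\sigma(r)-\sigma(r')}{r-r'}\le 1$ for all $r\neq r'$. Suppose $\mathrm{rank}(A)=n$ and there exists a diagonal matrix $\Omega=\mathrm{diag}(\omega_1,\dots,\omega_\ell)$ with all $\omega_i>0$ such that $$\Omega\Big(AW-\frac{1}{\tau}I\Big)+\Big(W^\top A^\top-\frac{1}{\tau}I\Big)\Omega \prec 0.$$ Then the system is input-to-state stable (ISS).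
   Context: The system is assumed (after a translation of coordinates) to have its equilibrium for zero input at the origin. The system $\dot x=f(x,u)$ is ISS if there exist a class $\mathcal{KL}$ function $\beta$ and a class $\mathcal{K}_\infty$ function $\gamma$ such that for every bounded input $u:[0,\infty)\to\mathbb{R}^m$ and every initial condition $x(0)=x_0$, the solution satisfies $\|x(t)\|\le \beta(\|x_0\|,t)+\gamma(\|u\|_\infty)$ for all $t\ge 0$. $M\prec 0$ means $M$ is symmetric negative definite. *)

theory Defs
  imports "HOL-Analysis.Analysis"
begin

text \<open>Comparison functions (Khalil's conventions), on the domain [0,\<infinity>).\<close>

definition class_K :: "(real \<Rightarrow> real) \<Rightarrow> bool" where
  "class_K \<gamma> \<longleftrightarrow> continuous_on {0..} \<gamma> \<and> \<gamma> 0 = 0 \<and> strict_mono_on {0..} \<gamma>"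

definition class_K_inf :: "(real \<Rightarrow> real) \<Rightarrow> bool" where
  "class_K_inf \<gamma> \<longleftrightarrow> class_K \<gamma> \<and> filterlim \<gamma> at_top at_top"

definition class_KL :: "(real \<Rightarrow> real \<Rightarrow> real) \<Rightarrow> bool" where
  "class_KL \<beta> \<longleftrightarrow>
     (\<forall>t\<ge>0. class_K (\<lambda>r. \<beta> r t)) \<and>
     (\<forall>r\<ge>0. antimono_on {0..} (\<lambda>t. \<beta> r t) \<and> ((\<lambda>t. \<beta> r t) \<longlongrightarrow> 0) at_top)"

text \<open>Input-to-state stability of \<open>x' = f x u\<close> with respect to an equilibrium for zero input.
  Inputs: Lebesgue measurable, bounded on [0,\<infinity>); solutions in the Caratheodory sense
  (continuous and satisfying the integral equation).  The norm of the input is the sup norm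
  on [0,\<infinity>).\<close>

definition ISS :: "(real^'n \<Rightarrow> real^'m \<Rightarrow> real^'n) \<Rightarrow> bool" where
  "ISS f \<longleftrightarrow> (\<exists>xe. f xe 0 = 0 \<and> (\<exists>\<beta> \<gamma>. class_KL \<beta> \<and> class_K_inf \<gamma> \<and>
     (\<forall>(u::real \<Rightarrow> real^'m) (x::real \<Rightarrow> real^'n).
        u measurable_on {0..} \<and> bounded (u ` {0..}) \<and>
        continuous_on {0..} x \<and>
        (\<forall>t\<ge>0. ((\<lambda>s. f (x s) (u s)) has_integral (x t - x 0)) {0..t})
        \<longrightarrow> (\<forall>t\<ge>0. norm (x t - xe) \<le> \<beta> (norm (x 0 - xe)) t + \<gamma> (Sup ((\<lambda>s. norm (u s)) ` {0..}))))))"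

definition neg_definite :: "real^'k^'k \<Rightarrow> bool" where
  "neg_definite M \<longleftrightarrow> transpose M = M \<and> (\<forall>z. z \<noteq> 0 \<longrightarrow> z \<bullet> (M *v z) < 0)"

definition diag_mat :: "real^'k \<Rightarrow> real^'k^'k" where
  "diag_mat w = (\<chi> i j. if i = j then w $ i else 0)"

definition sigma_vec :: "(real \<Rightarrow> real) \<Rightarrow> real^'l \<Rightarrow> real^'l" where
  "sigma_vec \<sigma> w = (\<chi> i. \<sigma> (w $ i))"

definition crnn :: "real \<Rightarrow> real^'l^'n \<Rightarrow> real^'n^'l \<Rightarrow> real^'m^'l \<Rightarrow> real^'l \<Rightarrow> real^'n
                    \<Rightarrow> (real \<Rightarrow> real) \<Rightarrow> real^'n \<Rightarrow> real^'m \<Rightarrow> real^'n" where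
  "crnn \<tau> W A B \<mu> \<nu> \<sigma> x u = - (1/\<tau>) *\<^sub>R x + W *v sigma_vec \<sigma> (A *v x + B *v u + \<mu>) + \<nu>"

end

theory Submission
  imports Defs
begin

(* Pick an equilibrium x_e and pass to y = A (x - x_e); as A has full column rank it suffices to
   bound y. Then y' = - y / tau + T phi(y) + q with T = A W, a diagonal slope-restricted
   nonlinearity phi and a disturbance q = O(|u|). The Lur'e-Postnikov function
   V(y) = |y|^2 / 2 + K sum_i omega_i Phi_i(y_i), where Phi_i' = phi_i, is comparable to |y|^2
   and, by the diagonal LMI, satisfies grad V(y) . y' <= C |q|^2 - |y|^2 / (4 tau). Solutions are
   only Caratheodory, so the comparison argument runs with upper right Dini derivatives; it
   yields exponential ISS. The equilibrium exists by Brouwer's theorem: for a small step h the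
   map y -> y + h (drift y + c) sends every large sublevel set of V into itself. *)

section \<open>Slope-restricted functions\<close>

text \<open>Slopes of \<open>f\<close> lie in \<open>[0, 1]\<close>; the form without division also covers \<open>a = b\<close>.\<close>

definition slope_restricted :: "(real \<Rightarrow> real) \<Rightarrow> bool" where
  "slope_restricted f \<longleftrightarrow> (\<forall>a b. (f b - f a)^2 \<le> (f b - f a) * (b - a))"

lemma slope_restrictedD: "slope_restricted f \<Longrightarrow> (f b - f a)^2 \<le> (f b - f a) * (b - a)"
  by (simp add: slope_restricted_def)

lemma slope_restricted_if_difference_quotient:
  assumes "\<And>r r'. r \<noteq> r' \<Longrightarrow> 0 \<le> (f r - f r') / (r - r') \<and> (f r - f r') / (r - r') \<le> 1"
  shows "slope_restricted f"
  unfolding slope_restricted_def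
proof (intro allI)
  fix a b :: real
  show "(f b - f a)^2 \<le> (f b - f a) * (b - a)"
  proof (cases "a = b")
    case False
    define s where "s = (f b - f a) / (b - a)"
    have s: "0 \<le> s" "s \<le> 1" using assms[of b a] False by (auto simp: s_def)
    have "(s * (b - a))^2 = (s * s) * (b - a)^2" by (simp add: power2_eq_square)
    also have "\<dots> \<le> s * (b - a)^2" by (intro mult_right_mono mult_right_le_one_le) (use s in auto)
    also have "\<dots> = s * (b - a) * (b - a)" by (simp add: power2_eq_square)
    finally show ?thesis using False by (simp add: s_def)
  qed simp
qed

lemma slope_restricted_shift:
  "slope_restricted f \<Longrightarrow> slope_restricted (\<lambda>r. f (r + c) - d)"
  unfolding slope_restricted_def by (metis add_diff_cancel_right diff_diff_eq2 diff_add_cancel)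

lemma slope_restricted_monotone:
  "slope_restricted f \<Longrightarrow> 0 \<le> (f b - f a) * (b - a)"
  by (metis slope_restrictedD zero_le_power2 order_trans)

lemma slope_restricted_lipschitz:
  assumes "slope_restricted f"
  shows "\<bar>f b - f a\<bar> \<le> \<bar>b - a\<bar>"
proof (cases "f b = f a")
  case False
  have "\<bar>f b - f a\<bar> * \<bar>f b - f a\<bar> \<le> \<bar>f b - f a\<bar> * \<bar>b - a\<bar>"
    using slope_restrictedD[OF assms, of b a] by (simp add: power2_eq_square abs_mult[symmetric])
  then show ?thesis
    using False by (metis mult_le_cancel_left_pos zero_less_abs_iff eq_iff_diff_eq_0)
qed simp

lemma slope_restricted_continuous:
  assumes "slope_restricted f"
  shows "continuous_on UNIV f"
proof (rule lipschitz_on_continuous_on)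
  show "1-lipschitz_on UNIV f"
    by (rule lipschitz_onI) (use slope_restricted_lipschitz[OF assms] in \<open>auto simp: dist_real_def\<close>)
qed

lemma exists_antiderivative:
  fixes f :: "real \<Rightarrow> real"
  assumes "continuous_on UNIV f"
  obtains F where "F 0 = 0" "\<And>r. (F has_real_derivative f r) (at r)"
proof -
  obtain G where "\<And>r. (G has_vector_derivative f r) (at r)"
    using einterval_antiderivative[of "-\<infinity>" "\<infinity>" f] assms
    by (auto simp: continuous_on_eq_continuous_at)
  then have "\<And>r. (G has_real_derivative f r) (at r)"
    by (simp add: has_real_derivative_iff_has_vector_derivative)
  then have "\<And>r. ((\<lambda>r. G r - G 0) has_real_derivative f r - 0) (at r)"
    by (intro DERIV_diff DERIV_const)
  then show ?thesis by (intro that[of "\<lambda>r. G r - G 0"]) auto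
qed

lemma deriv_sign_change_imp_max:
  fixes g :: "real \<Rightarrow> real"
  assumes deriv: "\<And>x. (g has_real_derivative g' x) (at x)"
    and "\<And>x. x < a \<Longrightarrow> 0 \<le> g' x" and "\<And>x. a < x \<Longrightarrow> g' x \<le> 0"
  shows "g b \<le> g a"
proof -
  have cont: "continuous_on S g" for S
    using deriv by (meson DERIV_isCont continuous_at_imp_continuous_on)
  show ?thesis
  proof (cases "b \<le> a")
    case True
    then show ?thesis
      by (rule DERIV_nonneg_imp_increasing_open) (use deriv assms(2) cont in auto)
  next
    case False
    then show ?thesis
      by (intro DERIV_nonpos_imp_decreasing_open[of a b]) (use deriv assms(3) cont in auto)
  qed
qed

lemma slope_restricted_antiderivative_bounds:
  assumes f: "slope_restricted f" and F: "\<And>r. (F has_real_derivative f r) (at r)"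
  shows "f a * (b - a) \<le> F b - F a" and "F b - F a \<le> f a * (b - a) + (b - a)^2 / 2"
proof -
  have "f a * b - F b \<le> f a * a - F a"
  proof (rule deriv_sign_change_imp_max[where g = "\<lambda>x. f a * x - F x" and g' = "\<lambda>x. f a - f x"])
    show "((\<lambda>x. f a * x - F x) has_real_derivative f a - f x) (at x)" for x
      by (auto intro!: derivative_eq_intros F)
    show "0 \<le> f a - f x" if "x < a" for x
      using slope_restricted_monotone[OF f, of x a] that by (simp add: zero_le_mult_iff)
    show "f a - f x \<le> 0" if "a < x" for x
      using slope_restricted_monotone[OF f, of a x] that by (simp add: zero_le_mult_iff)
  qed
  then show "f a * (b - a) \<le> F b - F a" by (simp add: algebra_simps)
  have "F b - f a * b - (b - a)^2 / 2 \<le> F a - f a * a - (a - a)^2 / 2"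
  proof (rule deriv_sign_change_imp_max[where g = "\<lambda>x. F x - f a * x - (x - a)^2 / 2"
        and g' = "\<lambda>x. f x - f a - (x - a)"])
    show "((\<lambda>x. F x - f a * x - (x - a)^2 / 2) has_real_derivative f x - f a - (x - a)) (at x)"
      for x
      by (auto intro!: derivative_eq_intros F simp: field_simps)
    show "0 \<le> f x - f a - (x - a)" if "x < a" for x
      using slope_restricted_lipschitz[OF f, of a x] that by auto
    show "f x - f a - (x - a) \<le> 0" if "a < x" for x
      using slope_restricted_lipschitz[OF f, of x a] that by auto
  qed
  then show "F b - F a \<le> f a * (b - a) + (b - a)^2 / 2" by (simp add: algebra_simps)
qed

lemma le_add_if_square_le_sum_squares:
  fixes x a b :: real
  assumes "x^2 \<le> a^2 + b^2" "0 \<le> a" "0 \<le> b"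
  shows "x \<le> a + b"
proof (rule power2_le_imp_le)
  have "0 \<le> 2 * a * b" using assms(2,3) by simp
  then show "x^2 \<le> (a + b)^2"
    using assms(1) by (simp add: power2_sum)
qed (use assms in simp)

lemma completing_squares_le:
  fixes \<tau> N G a b c :: real
  assumes "\<tau> > 0"
  shows "N * b * a - \<tau> * N^2 / 2 * b^2 + G * a * c - a^2 / \<tau> \<le> \<tau> * G^2 * c^2 - a^2 / (4 * \<tau>)"
proof -
  have "(a - \<tau> * N * b)^2 / (2 * \<tau>) = a^2 / (2 * \<tau>) - N * b * a + \<tau> * N^2 / 2 * b^2"
    using assms by (simp add: power2_eq_square field_simps)
  moreover have "(a - 2 * \<tau> * G * c)^2 / (4 * \<tau>) = a^2 / (4 * \<tau>) - G * a * c + \<tau> * G^2 * c^2"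
    using assms by (simp add: power2_eq_square field_simps)
  moreover have "a^2 / \<tau> = a^2 / (2 * \<tau>) + a^2 / (4 * \<tau>) + a^2 / (4 * \<tau>)"
    using assms by (simp add: field_simps)
  moreover have "0 \<le> (a - \<tau> * N * b)^2 / (2 * \<tau>)" "0 \<le> (a - 2 * \<tau> * G * c)^2 / (4 * \<tau>)"
    using assms by simp_all
  ultimately show ?thesis by linarith
qed

lemma square_perturbation_le:
  fixes K Q e :: real
  assumes "0 \<le> K" "0 \<le> Q" "0 < e"
  obtains \<epsilon> where "0 < \<epsilon>" "\<epsilon> \<le> 1" "K * (Q + \<epsilon>)^2 \<le> K * Q^2 + e"
proof
  define D where "D = K * (2 * Q + 1) + 1"
  define \<epsilon> where "\<epsilon> = min 1 (e / D)"
  have "D > 0" using assms by (simp add: D_def add_nonneg_pos)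
  then show "0 < \<epsilon>" "\<epsilon> \<le> 1" using assms by (auto simp: \<epsilon>_def)
  have "\<epsilon> * \<epsilon> \<le> \<epsilon>" using \<open>0 < \<epsilon>\<close> \<open>\<epsilon> \<le> 1\<close> by (simp add: mult_left_le_one_le)
  then have "(Q + \<epsilon>)^2 \<le> Q^2 + \<epsilon> * (2 * Q + 1)" by (simp add: power2_eq_square algebra_simps)
  then have "K * (Q + \<epsilon>)^2 \<le> K * (Q^2 + \<epsilon> * (2 * Q + 1))"
    using \<open>0 \<le> K\<close> by (rule mult_left_mono)
  also have "\<dots> = K * Q^2 + \<epsilon> * (K * (2 * Q + 1))" by (simp add: algebra_simps)
  also have "\<dots> \<le> K * Q^2 + \<epsilon> * D"
    using \<open>0 < \<epsilon>\<close> by (simp add: D_def)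
  also have "\<dots> \<le> K * Q^2 + e"
    using \<open>D > 0\<close> by (simp add: \<epsilon>_def min_def le_divide_eq)
  finally show "K * (Q + \<epsilon>)^2 \<le> K * Q^2 + e" .
qed

section \<open>Comparison principle for upper right Dini derivatives\<close>

lemma upper_right_dini_nonpos_imp_le:
  fixes z :: "real \<Rightarrow> real"
  assumes "a \<le> b" and cont: "continuous_on {a..b} z"
    and dini: "\<And>t e. t \<in> {a..<b} \<Longrightarrow> e > 0 \<Longrightarrow> \<exists>\<delta>>0. \<forall>h. 0 < h \<and> h < \<delta> \<longrightarrow> z (t + h) \<le> z t + e * h"
  shows "z b \<le> z a"
proof (cases "a = b")
  case False
  have "z b \<le> z a + e * (b - a)" if e: "e > 0" for e
  proof -
    define S where "S = {t \<in> {a..b}. z t \<le> z a + e * (t - a)}"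
    have "closed S" unfolding S_def
      by (intro continuous_on_closed_Collect_le[OF cont] continuous_intros)
    moreover have "a \<in> S" "bdd_above S"
      using \<open>a \<le> b\<close> by (auto simp: S_def intro: bdd_aboveI[of _ b])
    ultimately have s: "Sup S \<in> S" using closed_contains_Sup by blast
    have "Sup S = b"
    proof (rule ccontr)
      assume "Sup S \<noteq> b"
      then have "Sup S \<in> {a..<b}" using s by (auto simp: S_def)
      with dini e obtain \<delta> where "\<delta> > 0"
        and \<delta>: "\<And>h. 0 < h \<and> h < \<delta> \<Longrightarrow> z (Sup S + h) \<le> z (Sup S) + e * h"
        by blast
      define h where "h = min (\<delta> / 2) (b - Sup S)"
      have h: "0 < h" "h < \<delta>" "Sup S + h \<le> b"
        using \<open>\<delta> > 0\<close> \<open>Sup S \<in> {a..<b}\<close> by (auto simp: h_def)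
      have "z (Sup S + h) \<le> z a + e * (Sup S + h - a)"
        using \<delta>[of h] h s by (auto simp: S_def algebra_simps)
      then have "Sup S + h \<in> S" using h s by (auto simp: S_def)
      then have "Sup S + h \<le> Sup S" using \<open>bdd_above S\<close> by (rule cSup_upper)
      then show False using h by simp
    qed
    then show ?thesis using s by (simp add: S_def)
  qed
  moreover have "b - a > 0" using False \<open>a \<le> b\<close> by simp
  ultimately have "z b \<le> z a + e" if "e > 0" for e
    using that by (metis divide_pos_pos nonzero_eq_divide_eq order_less_irrefl)
  then show ?thesis by (rule field_le_epsilon)
qed simp

lemma exp_mult_one_minus_bound:
  fixes x :: real
  assumes "0 \<le> x" "x \<le> 1"
  shows "\<bar>exp x * (1 - x) - 1\<bar> \<le> x^2"
proof -
  have "exp x * (1 - x) \<le> exp x * exp (- x)"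
    using exp_ge_add_one_self[of "-x"] assms by (intro mult_left_mono) auto
  moreover have "(1 + x) * (1 - x) \<le> exp x * (1 - x)"
    using exp_ge_add_one_self[of x] assms by (intro mult_right_mono) auto
  ultimately show ?thesis by (simp add: exp_minus power2_eq_square algebra_simps)
qed

lemma exp_weighted_step_le:
  fixes k h e w w' :: real
  assumes "k > 0" "0 < h" "k * h \<le> 1" "e \<ge> 0" and step: "w' \<le> w + h * (E - k * w + e)"
  shows "exp (k * (s + h)) * (w' - E / k)
           \<le> exp (k * s) * (w - E / k) + exp (k * s) * h * (k^2 * h * \<bar>w - E / k\<bar> + 3 * e)"
proof -
  define q where "q = w - E / k"
  have "(1 - k * h) * q + h * e = w - E / k + h * (E - k * w + e)"
    using \<open>k > 0\<close> by (simp add: q_def field_simps)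
  then have "w' - E / k \<le> (1 - k * h) * q + h * e" using step by linarith
  then have "exp (k * h) * (w' - E / k) \<le> exp (k * h) * ((1 - k * h) * q + h * e)"
    by (intro mult_left_mono) auto
  also have "\<dots> = q + (exp (k * h) * (1 - k * h) - 1) * q + exp (k * h) * h * e"
    by (simp add: algebra_simps)
  also have "\<dots> \<le> q + (k * h)^2 * \<bar>q\<bar> + 3 * h * e"
  proof (intro add_mono order.refl)
    have "(exp (k * h) * (1 - k * h) - 1) * q \<le> \<bar>exp (k * h) * (1 - k * h) - 1\<bar> * \<bar>q\<bar>"
      by (metis abs_ge_self abs_mult)
    also have "\<dots> \<le> (k * h)^2 * \<bar>q\<bar>"
      using assms by (intro mult_right_mono exp_mult_one_minus_bound) auto
    finally show "(exp (k * h) * (1 - k * h) - 1) * q \<le> (k * h)^2 * \<bar>q\<bar>" .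
    have "exp (k * h) \<le> 3"
      using \<open>k * h \<le> 1\<close> exp_le by (meson exp_le_cancel_iff order_trans)
    then show "exp (k * h) * h * e \<le> 3 * h * e"
      using assms by (intro mult_right_mono) auto
  qed
  finally have "exp (k * h) * (w' - E / k) \<le> q + h * (k^2 * h * \<bar>q\<bar> + 3 * e)"
    by (simp add: power2_eq_square algebra_simps)
  from mult_left_mono[OF this exp_ge_zero[of "k * s"]] show ?thesis
    by (simp add: q_def distrib_left exp_add algebra_simps)
qed

text \<open>The upper right Dini derivative of \<open>e\<^sup>k\<^sup>t (w t - E / k)\<close> is nonpositive
  because \<open>e\<^sup>x (1 - x) = 1 + O(x\<^sup>2)\<close>.\<close>

lemma dini_comparison_exp:
  fixes w :: "real \<Rightarrow> real"
  assumes "k > 0" and cont: "continuous_on {0..} w"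
    and dini: "\<And>t e. t \<ge> 0 \<Longrightarrow> e > 0 \<Longrightarrow>
                 \<exists>\<delta>>0. \<forall>h. 0 < h \<and> h < \<delta> \<longrightarrow> w (t + h) \<le> w t + h * (E - k * w t + e)"
    and "t \<ge> 0"
  shows "w t \<le> E / k + exp (- k * t) * (w 0 - E / k)"
proof -
  define z where "z s = exp (k * s) * (w s - E / k)" for s
  have "z t \<le> z 0"
  proof (rule upper_right_dini_nonpos_imp_le[where z = z])
    show "continuous_on {0..t} z"
      unfolding z_def by (intro continuous_intros continuous_on_subset[OF cont]) auto
    fix s e :: real assume s: "s \<in> {0..<t}" and "e > 0"
    define X where "X = exp (k * s)"
    define B where "B = 2 * X * k^2 * \<bar>w s - E / k\<bar> + 1"
    have "X > 0" "B > 0" by (simp_all add: X_def B_def add_nonneg_pos)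
    obtain \<delta> where "\<delta> > 0" and
      \<delta>: "\<And>h. 0 < h \<and> h < \<delta> \<Longrightarrow> w (s + h) \<le> w s + h * (E - k * w s + e / (6 * X))"
      using dini[of s "e / (6 * X)"] s \<open>e > 0\<close> \<open>X > 0\<close> by auto
    define \<delta>' where "\<delta>' = min \<delta> (min (1 / k) (e / B))"
    have "z (s + h) \<le> z s + e * h" if h: "0 < h" "h < \<delta>'" for h
    proof -
      have "k * h \<le> 1" "h * B \<le> e"
        using h \<open>k > 0\<close> \<open>B > 0\<close> by (auto simp: \<delta>'_def field_simps)
      then have "X * (k^2 * h * \<bar>w s - E / k\<bar>) \<le> e / 2"
        using h by (simp add: B_def algebra_simps)
      then have "h * (X * (k^2 * h * \<bar>w s - E / k\<bar>)) \<le> h * (e / 2)"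
        using h by (intro mult_left_mono) auto
      moreover have "X * h * (k^2 * h * \<bar>w s - E / k\<bar> + 3 * (e / (6 * X)))
          = h * (X * (k^2 * h * \<bar>w s - E / k\<bar>)) + h * (e / 2)"
        using \<open>X > 0\<close> by (simp add: field_simps)
      ultimately have "X * h * (k^2 * h * \<bar>w s - E / k\<bar> + 3 * (e / (6 * X)))
          \<le> h * (e / 2) + h * (e / 2)"
        by linarith
      then have bound: "X * h * (k^2 * h * \<bar>w s - E / k\<bar> + 3 * (e / (6 * X))) \<le> e * h"
        by (simp add: field_simps)
      have step: "w (s + h) \<le> w s + h * (E - k * w s + e / (6 * X))"
        using \<delta>[of h] h by (simp add: \<delta>'_def)
      have "0 \<le> e / (6 * X)" using \<open>e > 0\<close> \<open>X > 0\<close> by simp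
      from exp_weighted_step_le[OF \<open>k > 0\<close> \<open>0 < h\<close> \<open>k * h \<le> 1\<close> this step]
      have "z (s + h) \<le> z s + X * h * (k^2 * h * \<bar>w s - E / k\<bar> + 3 * (e / (6 * X)))"
        by (simp add: z_def X_def)
      with bound show ?thesis by linarith
    qed
    moreover have "\<delta>' > 0" using \<open>\<delta> > 0\<close> \<open>k > 0\<close> \<open>e > 0\<close> \<open>B > 0\<close> by (simp add: \<delta>'_def)
    ultimately show "\<exists>\<delta>>0. \<forall>h. 0 < h \<and> h < \<delta> \<longrightarrow> z (s + h) \<le> z s + e * h" by blast
  qed (use \<open>t \<ge> 0\<close> in auto)
  then show ?thesis
    by (simp add: z_def exp_minus field_simps)
qed

section \<open>Matrices, quadratic forms and sublevel sets\<close>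

lemma diag_mat_mult_vec: "diag_mat w *v z = (\<chi> i. w $ i * z $ i)"
proof -
  have "(\<Sum>j\<in>UNIV. (if i = j then w $ i else 0) * z $ j)
      = (\<Sum>j\<in>UNIV. if i = j then w $ i * z $ j else 0)" for i
    by (rule sum.cong) auto
  then show ?thesis by (simp add: diag_mat_def matrix_vector_mult_def vec_eq_iff)
qed

lemma transpose_diag_mat [simp]: "transpose (diag_mat w) = diag_mat w"
  by (simp add: diag_mat_def transpose_def vec_eq_iff)

lemma inner_diag_mat: "(diag_mat w *v z) \<bullet> y = (\<Sum>i\<in>UNIV. w $ i * z $ i * y $ i)"
  by (simp add: diag_mat_mult_vec inner_vec_def)

lemma quadratic_form_symmetrized:
  fixes P X :: "real^'k^'k"
  assumes "transpose P = P"
  shows "z \<bullet> ((P ** X + transpose X ** P) *v z) = 2 * ((P *v z) \<bullet> (X *v z))"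
proof -
  have "z \<bullet> (P *v v) = (P *v z) \<bullet> v" for v
    by (metis assms dot_lmul_matrix vector_transpose_matrix)
  moreover have "z \<bullet> (transpose X *v v) = (X *v z) \<bullet> v" for v
    by (metis dot_lmul_matrix vector_transpose_matrix)
  ultimately show ?thesis
    by (simp add: matrix_vector_mult_add_rdistrib matrix_vector_mul_assoc[symmetric]
        inner_add_right inner_commute)
qed

lemma neg_definite_uniform:
  fixes M :: "real^'k^'k"
  assumes "neg_definite M"
  obtains l where "l > 0" "\<And>z. z \<bullet> (M *v z) \<le> - l * (norm z)^2"
proof -
  let ?S = "sphere (0::real^'k) 1"
  have "?S \<noteq> {}" by (metis norm_axis_1 mem_sphere_0 empty_iff)
  moreover have "continuous_on ?S (\<lambda>z. z \<bullet> (M *v z))" by (intro continuous_intros)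
  ultimately obtain z0 where z0: "z0 \<in> ?S" and max: "\<And>y. y \<in> ?S \<Longrightarrow> y \<bullet> (M *v y) \<le> z0 \<bullet> (M *v z0)"
    using continuous_attains_sup[OF compact_sphere] by blast
  have "z \<bullet> (M *v z) \<le> (z0 \<bullet> (M *v z0)) * (norm z)^2" for z
  proof (cases "z = 0")
    case False
    have "(z /\<^sub>R norm z) \<bullet> (M *v (z /\<^sub>R norm z)) \<le> z0 \<bullet> (M *v z0)"
      using False by (intro max) simp
    then show ?thesis
      using False by (simp add: matrix_vector_mult_scaleR power2_eq_square field_simps)
  qed simp
  moreover have "z0 \<noteq> 0" using z0 by auto
  then have "z0 \<bullet> (M *v z0) < 0"
    using assms by (simp add: neg_definite_def)
  ultimately show ?thesis by (intro that[of "- (z0 \<bullet> (M *v z0))"]) auto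
qed

lemma inner_matrix_vector_le_onorm:
  fixes M :: "real^'a^'b"
  shows "(M *v v) \<bullet> w \<le> onorm ((*v) M) * norm v * norm w"
proof -
  have "(M *v v) \<bullet> w \<le> norm (M *v v) * norm w" by (rule norm_cauchy_schwarz)
  also have "\<dots> \<le> onorm ((*v) M) * norm v * norm w"
    by (rule mult_right_mono[OF onorm[OF matrix_vector_mul_bounded_linear] norm_ge_zero])
  finally show ?thesis .
qed

lemma convex_sublevel_if_tangent_minorant:
  fixes f :: "'a::real_inner \<Rightarrow> real"
  assumes tangent: "\<And>a d. f a + g a \<bullet> d \<le> f (a + d)"
  shows "convex {z. f z \<le> R}"
proof (rule convexI)
  fix x y and u v :: real
  assume "x \<in> {z. f z \<le> R}" "y \<in> {z. f z \<le> R}" "0 \<le> u" "0 \<le> v" "u + v = 1"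
  define z where "z = u *\<^sub>R x + v *\<^sub>R y"
  have "u *\<^sub>R (x - z) + v *\<^sub>R (y - z) = (u *\<^sub>R x + v *\<^sub>R y) - (u + v) *\<^sub>R z"
    by (simp add: algebra_simps)
  then have "u *\<^sub>R (x - z) + v *\<^sub>R (y - z) = 0"
    using \<open>u + v = 1\<close> by (simp add: z_def)
  have "u * (f z + g z \<bullet> (x - z)) + v * (f z + g z \<bullet> (y - z))
      = (u + v) * f z + g z \<bullet> (u *\<^sub>R (x - z) + v *\<^sub>R (y - z))"
    by (simp add: algebra_simps)
  then have "f z = u * (f z + g z \<bullet> (x - z)) + v * (f z + g z \<bullet> (y - z))"
    using \<open>u + v = 1\<close> \<open>u *\<^sub>R (x - z) + v *\<^sub>R (y - z) = 0\<close> by simp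
  also have "\<dots> \<le> u * f x + v * f y"
    using tangent[of z "x - z"] tangent[of z "y - z"] \<open>0 \<le> u\<close> \<open>0 \<le> v\<close>
    by (intro add_mono mult_left_mono) auto
  also have "\<dots> \<le> u * R + v * R"
    using \<open>x \<in> _\<close> \<open>y \<in> _\<close> \<open>0 \<le> u\<close> \<open>0 \<le> v\<close> by (intro add_mono mult_left_mono) auto
  finally show "u *\<^sub>R x + v *\<^sub>R y \<in> {z. f z \<le> R}"
    using \<open>u + v = 1\<close> by (simp add: z_def flip: distrib_right)
qed

lemma fixed_point_if_sublevel_invariant:
  fixes V :: "'a::euclidean_space \<Rightarrow> real" and P :: "'a \<Rightarrow> 'a"
  assumes "continuous_on UNIV V" "continuous_on UNIV P"
    and "\<And>R. convex {z. V z \<le> R}" "\<And>R. bounded {z. V z \<le> R}"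
    and invariant: "\<And>z. V (P z) \<le> max (V z) R0"
  obtains z where "P z = z"
proof -
  define S where "S = {z. V z \<le> max R0 (V 0)}"
  have "closed S"
    unfolding S_def using \<open>continuous_on UNIV V\<close> by (intro closed_Collect_le) auto
  then have "compact S" using assms(4) by (simp add: S_def compact_eq_bounded_closed)
  moreover have "0 \<in> S" by (simp add: S_def)
  moreover have "P z \<in> S" if "z \<in> S" for z
    using invariant[of z] that by (auto simp: S_def max_def split: if_splits)
  then have "P \<in> S \<rightarrow> S" by blast
  moreover have "convex S" using assms(3) by (simp add: S_def)
  moreover have "continuous_on S P" using \<open>continuous_on UNIV P\<close> by (rule continuous_on_subset) simp
  ultimately obtain z where "z \<in> S" "P z = z" by (metis brouwer empty_iff)
  then show ?thesis using that by blast
qed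

section \<open>Caratheodory solutions\<close>

definition caratheodory_solution ::
    "('a::real_normed_vector \<Rightarrow> 'b \<Rightarrow> 'a) \<Rightarrow> (real \<Rightarrow> 'a) \<Rightarrow> (real \<Rightarrow> 'b) \<Rightarrow> bool" where
  "caratheodory_solution f x u \<longleftrightarrow> continuous_on {0..} x \<and>
     (\<forall>t\<ge>0. ((\<lambda>s. f (x s) (u s)) has_integral (x t - x 0)) {0..t})"

lemma caratheodory_solution_affine_image:
  assumes sol: "caratheodory_solution f x u" and L: "bounded_linear L"
    and eq: "\<And>s. s \<ge> 0 \<Longrightarrow> L (f (x s) (u s)) = g (L (x s) + c) (v s)"
  shows "caratheodory_solution g (\<lambda>s. L (x s) + c) v"
  unfolding caratheodory_solution_def
proof (intro conjI allI impI)
  show "continuous_on {0..} (\<lambda>s. L (x s) + c)"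
    using sol unfolding caratheodory_solution_def
    by (intro continuous_intros continuous_on_compose2[OF linear_continuous_on[OF L]]) auto
  fix t :: real assume "t \<ge> 0"
  then have "((\<lambda>s. f (x s) (u s)) has_integral (x t - x 0)) {0..t}"
    using sol by (simp add: caratheodory_solution_def)
  from has_integral_linear[OF this L]
  have "((\<lambda>s. L (f (x s) (u s))) has_integral L (x t - x 0)) {0..t}"
    by (simp add: o_def)
  then have "((\<lambda>s. g (L (x s) + c) (v s)) has_integral L (x t - x 0)) {0..t}"
    by (rule has_integral_eq[rotated]) (auto simp: eq)
  then show "((\<lambda>s. g (L (x s) + c) (v s)) has_integral (L (x t) + c - (L (x 0) + c))) {0..t}"
    by (simp add: linear_diff[OF bounded_linear.linear[OF L]])
qed

lemma caratheodory_solution_has_integral: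
  fixes f :: "'a::euclidean_space \<Rightarrow> 'b \<Rightarrow> 'a"
  assumes sol: "caratheodory_solution f x u" and "0 \<le> t" "t \<le> t'"
  shows "((\<lambda>s. f (x s) (u s)) has_integral (x t' - x t)) {t..t'}"
proof -
  have int: "\<And>r. r \<ge> 0 \<Longrightarrow> ((\<lambda>s. f (x s) (u s)) has_integral (x r - x 0)) {0..r}"
    using sol by (simp add: caratheodory_solution_def)
  have "(\<lambda>s. f (x s) (u s)) integrable_on {t..t'}"
    using assms(2,3)
    by (intro integrable_subinterval_real[OF has_integral_integrable[OF int[of t']]]) auto
  then obtain I where I: "((\<lambda>s. f (x s) (u s)) has_integral I) {t..t'}" by blast
  have "((\<lambda>s. f (x s) (u s)) has_integral (x t - x 0) + I) {0..t'}"
    using assms(2,3) by (intro has_integral_combine[OF _ _ int[of t] I]) auto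
  then have "x t - x 0 + I = x t' - x 0"
    using int[of t'] assms(2,3) by (intro has_integral_unique) auto
  then have "I = x t' - x t" by (simp add: algebra_simps)
  with I show ?thesis by simp
qed

lemma caratheodory_solution_increment:
  fixes F :: "'a::euclidean_space \<Rightarrow> 'a"
  assumes sol: "caratheodory_solution (\<lambda>z v. F z + v) y q" and F: "continuous_on UNIV F"
    and q: "\<And>s. s \<ge> 0 \<Longrightarrow> norm (q s) \<le> Q" and "t \<ge> 0" and "\<epsilon> > 0"
  obtains \<delta> where "\<delta> > 0"
    "\<And>h. 0 < h \<Longrightarrow> h < \<delta> \<Longrightarrow> \<exists>v. y (t + h) = y t + h *\<^sub>R (F (y t) + v) \<and> norm v \<le> Q + \<epsilon>"
proof -
  have "continuous_on {0..} (\<lambda>s. F (y s))"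
    using sol by (auto simp: caratheodory_solution_def intro: continuous_on_compose2[OF F])
  then obtain \<delta> where "\<delta> > 0"
    and \<delta>: "\<And>s. s \<ge> 0 \<Longrightarrow> dist s t < \<delta> \<Longrightarrow> dist (F (y s)) (F (y t)) < \<epsilon>"
    using \<open>t \<ge> 0\<close> \<open>\<epsilon> > 0\<close> unfolding continuous_on_iff by (metis atLeast_iff)
  have "\<exists>v. y (t + h) = y t + h *\<^sub>R (F (y t) + v) \<and> norm v \<le> Q + \<epsilon>" if h: "0 < h" "h < \<delta>" for h
  proof -
    define I where "I = y (t + h) - y t"
    have deviation:
      "((\<lambda>s. F (y s) + q s - F (y t)) has_integral I - h *\<^sub>R F (y t)) (cbox t (t + h))"
      using has_integral_diff[OF caratheodory_solution_has_integral[OF sol, of t "t + h"]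
          has_integral_const_real[of "F (y t)" t "t + h"]] \<open>t \<ge> 0\<close> h
      by (simp add: I_def)
    have bound: "norm (F (y s) + q s - F (y t)) \<le> Q + \<epsilon>" if "s \<in> cbox t (t + h)" for s
    proof -
      have "norm (F (y s) - F (y t)) \<le> \<epsilon>"
        using \<delta>[of s] that h \<open>t \<ge> 0\<close> by (auto simp: dist_norm dist_real_def)
      then show ?thesis
        using q[of s] that \<open>t \<ge> 0\<close> norm_triangle_ineq[of "F (y s) - F (y t)" "q s"]
        by (simp add: algebra_simps)
    qed
    have "0 \<le> Q + \<epsilon>" using q[of 0] \<open>\<epsilon> > 0\<close> norm_ge_zero[of "q 0"] by linarith
    from has_integral_bound[OF this deviation bound] h
    have "norm (I - h *\<^sub>R F (y t)) \<le> (Q + \<epsilon>) * h" by (simp add: content_real)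
    then have "norm ((1 / h) *\<^sub>R (I - h *\<^sub>R F (y t))) \<le> Q + \<epsilon>"
      using h by (simp add: divide_le_eq mult.commute)
    moreover have "y (t + h) = y t + h *\<^sub>R (F (y t) + (1 / h) *\<^sub>R (I - h *\<^sub>R F (y t)))"
      using h by (simp add: I_def scaleR_add_right)
    ultimately show ?thesis by blast
  qed
  then show ?thesis using \<open>\<delta> > 0\<close> that by blast
qed

section \<open>Lur'e systems satisfying a diagonal LMI\<close>

text \<open>The CRNN in the coordinates \<open>y = A (x - x\<^sub>e)\<close>: \<open>T = A W\<close> and
  \<open>\<phi> i r = \<sigma> (r + p\<^sub>i) - \<sigma> p\<^sub>i\<close> with \<open>p = A x\<^sub>e + \<mu>\<close>; the input enters as an additive disturbance.\<close>

locale lure_system =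
  fixes \<tau> :: real and T :: "real^'l^'l" and \<omega> :: "real^'l" and \<phi> :: "'l \<Rightarrow> real \<Rightarrow> real"
  assumes tau_pos: "\<tau> > 0"
    and weights_pos: "\<And>i. \<omega> $ i > 0"
    and phi_zero: "\<And>i. \<phi> i 0 = 0"
    and phi_slope: "\<And>i. slope_restricted (\<phi> i)"
    and lmi: "neg_definite (diag_mat \<omega> ** (T - (1/\<tau>) *\<^sub>R mat 1)
                              + (transpose T - (1/\<tau>) *\<^sub>R mat 1) ** diag_mat \<omega>)"
begin

definition phi_vec :: "real^'l \<Rightarrow> real^'l" where
  "phi_vec z = (\<chi> i. \<phi> i (z $ i))"

definition drift :: "real^'l \<Rightarrow> real^'l" where
  "drift z = - (1/\<tau>) *\<^sub>R z + T *v phi_vec z"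

lemma phi_vec_zero [simp]: "phi_vec 0 = 0"
  by (simp add: phi_vec_def phi_zero vec_eq_iff)

lemma phi_vec_lipschitz: "norm (phi_vec a - phi_vec b) \<le> norm (a - b)"
  by (rule norm_le_componentwise_cart)
    (simp add: phi_vec_def slope_restricted_lipschitz[OF phi_slope])

lemma norm_phi_vec_le: "norm (phi_vec z) \<le> norm z"
  using phi_vec_lipschitz[of z 0] by simp

lemma phi_vec_sector: "(phi_vec z $ i)^2 \<le> phi_vec z $ i * z $ i"
  using slope_restrictedD[OF phi_slope, where a = 0 and b = "z $ i"]
  by (simp add: phi_vec_def phi_zero)

lemma drift_lipschitz: "norm (drift a - drift b) \<le> (1/\<tau> + onorm ((*v) T)) * norm (a - b)"
proof -
  have "drift a - drift b = - (1/\<tau>) *\<^sub>R (a - b) + T *v (phi_vec a - phi_vec b)"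
    by (simp add: drift_def algebra_simps)
  also have "norm \<dots> \<le> (1/\<tau>) * norm (a - b) + onorm ((*v) T) * norm (phi_vec a - phi_vec b)"
    by (rule order_trans[OF norm_triangle_ineq add_mono])
      (use tau_pos in \<open>simp_all add: onorm[OF matrix_vector_mul_bounded_linear]\<close>)
  also have "\<dots> \<le> (1/\<tau>) * norm (a - b) + onorm ((*v) T) * norm (a - b)"
    using phi_vec_lipschitz onorm_pos_le[OF matrix_vector_mul_bounded_linear]
    by (intro add_left_mono mult_left_mono)
  finally show ?thesis by (simp add: algebra_simps)
qed

lemma continuous_drift: "continuous_on UNIV drift"
proof (rule lipschitz_on_continuous_on)
  show "(1/\<tau> + onorm ((*v) T))-lipschitz_on UNIV drift"
    using drift_lipschitz tau_pos onorm_pos_le[OF matrix_vector_mul_bounded_linear, of T]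
    by (intro lipschitz_onI) (auto simp: dist_norm)
qed

lemma norm_drift_le: "norm (drift z) \<le> (1/\<tau> + onorm ((*v) T)) * norm z"
  using drift_lipschitz[of z 0] by (simp add: drift_def)

definition lmi_margin :: real where
  "lmi_margin = (SOME m. m > 0 \<and>
     (\<forall>z. (diag_mat \<omega> *v z) \<bullet> (T *v z - (1/\<tau>) *\<^sub>R z) \<le> - m * (norm z)^2))"

lemma lmi_margin:
  "lmi_margin > 0" "(diag_mat \<omega> *v z) \<bullet> (T *v z - (1/\<tau>) *\<^sub>R z) \<le> - lmi_margin * (norm z)^2"
proof -
  define X where "X = T - (1/\<tau>) *\<^sub>R mat 1"
  have "transpose X = transpose T - (1/\<tau>) *\<^sub>R mat 1"
    by (simp add: X_def transpose_def vec_eq_iff mat_def)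
  then obtain l where "l > 0"
    and l: "\<And>z. z \<bullet> ((diag_mat \<omega> ** X + transpose X ** diag_mat \<omega>) *v z) \<le> - l * (norm z)^2"
    using neg_definite_uniform[OF lmi] unfolding X_def by metis
  have "X *v z = T *v z - (1/\<tau>) *\<^sub>R z" for z
    by (simp add: X_def matrix_vector_mult_diff_rdistrib scaleR_matrix_vector_assoc[symmetric])
  then have "(diag_mat \<omega> *v z) \<bullet> (T *v z - (1/\<tau>) *\<^sub>R z) \<le> - (l/2) * (norm z)^2" for z
    using l[of z] quadratic_form_symmetrized[where P = "diag_mat \<omega>" and X = X and z = z] by simp
  with \<open>l > 0\<close> have "\<exists>m. m > 0 \<and>
      (\<forall>z. (diag_mat \<omega> *v z) \<bullet> (T *v z - (1/\<tau>) *\<^sub>R z) \<le> - m * (norm z)^2)"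
    by (intro exI[of _ "l/2"]) auto
  from someI_ex[OF this] show "lmi_margin > 0"
    "(diag_mat \<omega> *v z) \<bullet> (T *v z - (1/\<tau>) *\<^sub>R z) \<le> - lmi_margin * (norm z)^2"
    unfolding lmi_margin_def by auto
qed


text \<open>The weight is chosen so that the LMI margin absorbs the cross term \<open>z \<bullet> T \<phi>(z)\<close>
  in \<open>lyap_dissipation\<close>.\<close>

definition lyap_weight :: real where
  "lyap_weight = \<tau> * (onorm ((*v) T))^2 / (2 * lmi_margin)"

definition lyap_gain :: real where
  "lyap_gain = 1 + lyap_weight * onorm ((*v) (diag_mat \<omega>))"

lemma lyap_weight_nonneg: "lyap_weight \<ge> 0"
  using lmi_margin(1) tau_pos by (simp add: lyap_weight_def)

lemma lyap_gain_ge_1: "lyap_gain \<ge> 1"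
  using lyap_weight_nonneg onorm_pos_le[OF matrix_vector_mul_bounded_linear, of "diag_mat \<omega>"]
  by (simp add: lyap_gain_def)

definition Phi :: "'l \<Rightarrow> real \<Rightarrow> real" where
  "Phi i = (SOME F. F 0 = 0 \<and> (\<forall>r. (F has_real_derivative \<phi> i r) (at r)))"

lemma Phi_zero: "Phi i 0 = 0"
  and Phi_has_real_derivative: "(Phi i has_real_derivative \<phi> i r) (at r)"
proof -
  obtain F where "F 0 = 0" "\<And>r. (F has_real_derivative \<phi> i r) (at r)"
    using exists_antiderivative[OF slope_restricted_continuous[OF phi_slope]] by blast
  then have "\<exists>F. F 0 = 0 \<and> (\<forall>r. (F has_real_derivative \<phi> i r) (at r))" by blast
  from someI_ex[OF this] show "Phi i 0 = 0" "(Phi i has_real_derivative \<phi> i r) (at r)"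
    unfolding Phi_def by auto
qed

lemmas Phi_bounds = slope_restricted_antiderivative_bounds[OF phi_slope Phi_has_real_derivative]

definition lyap :: "real^'l \<Rightarrow> real" where
  "lyap z = (norm z)^2 / 2 + lyap_weight * (\<Sum>i\<in>UNIV. \<omega> $ i * Phi i (z $ i))"

definition lyap_grad :: "real^'l \<Rightarrow> real^'l" where
  "lyap_grad z = z + lyap_weight *\<^sub>R (diag_mat \<omega> *v phi_vec z)"

lemma lyap_tangent_bounds:
  shows "lyap a + lyap_grad a \<bullet> d \<le> lyap (a + d)"
    and "lyap (a + d) \<le> lyap a + lyap_grad a \<bullet> d + lyap_gain / 2 * (norm d)^2"
proof -
  define S where "S = (\<Sum>i\<in>UNIV. \<omega> $ i * (Phi i (a $ i + d $ i) - Phi i (a $ i)))"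
  have Phi_incr: "\<phi> i (a $ i) * d $ i \<le> Phi i (a $ i + d $ i) - Phi i (a $ i)"
    "Phi i (a $ i + d $ i) - Phi i (a $ i) \<le> \<phi> i (a $ i) * d $ i + d $ i * d $ i / 2" for i
    using Phi_bounds[where i = i and a = "a $ i" and b = "a $ i + d $ i"]
    by (simp_all add: power2_eq_square)
  have S_lower: "(diag_mat \<omega> *v phi_vec a) \<bullet> d \<le> S"
    unfolding S_def inner_diag_mat using Phi_incr(1) weights_pos
    by (intro sum_mono) (simp add: phi_vec_def mult.assoc mult_left_mono less_imp_le)
  have "S \<le> (\<Sum>i\<in>UNIV. \<omega> $ i * (\<phi> i (a $ i) * d $ i + d $ i * d $ i / 2))"
    unfolding S_def using Phi_incr(2) weights_pos
    by (intro sum_mono mult_left_mono) (auto simp: less_imp_le)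
  also have "\<dots> = (diag_mat \<omega> *v phi_vec a) \<bullet> d + (diag_mat \<omega> *v d) \<bullet> d / 2"
    by (simp add: inner_diag_mat phi_vec_def sum.distrib sum_divide_distrib algebra_simps)
  also have "(diag_mat \<omega> *v d) \<bullet> d \<le> onorm ((*v) (diag_mat \<omega>)) * (norm d)^2"
    using inner_matrix_vector_le_onorm[of "diag_mat \<omega>" d d]
    by (simp add: power2_eq_square mult.assoc)
  finally have S_upper:
    "S \<le> (diag_mat \<omega> *v phi_vec a) \<bullet> d + onorm ((*v) (diag_mat \<omega>)) * (norm d)^2 / 2"
    by simp
  have lyap_diff: "lyap (a + d) - lyap a = a \<bullet> d + (norm d)^2 / 2 + lyap_weight * S"
    by (simp add: lyap_def S_def power2_norm_eq_inner inner_commute sum_subtractf algebra_simps)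
  have grad: "lyap_grad a \<bullet> d = a \<bullet> d + lyap_weight * ((diag_mat \<omega> *v phi_vec a) \<bullet> d)"
    by (simp add: lyap_grad_def inner_add_left)
  show "lyap a + lyap_grad a \<bullet> d \<le> lyap (a + d)"
    using mult_left_mono[OF S_lower lyap_weight_nonneg] lyap_diff grad zero_le_power2[of "norm d"]
    by linarith
  show "lyap (a + d) \<le> lyap a + lyap_grad a \<bullet> d + lyap_gain / 2 * (norm d)^2"
  proof -
    have "lyap_weight * S \<le> lyap_weight * ((diag_mat \<omega> *v phi_vec a) \<bullet> d)
        + lyap_weight * (onorm ((*v) (diag_mat \<omega>)) * (norm d)^2 / 2)"
      using mult_left_mono[OF S_upper lyap_weight_nonneg] by (simp add: distrib_left)
    moreover have "lyap_gain / 2 * (norm d)^2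
        = (norm d)^2 / 2 + lyap_weight * (onorm ((*v) (diag_mat \<omega>)) * (norm d)^2 / 2)"
      by (simp add: lyap_gain_def algebra_simps)
    ultimately show ?thesis using lyap_diff grad by linarith
  qed
qed

lemma lyap_zero [simp]: "lyap 0 = 0" and lyap_grad_zero [simp]: "lyap_grad 0 = 0"
  by (simp_all add: lyap_def lyap_grad_def Phi_zero)

lemma lyap_bounds: "(norm z)^2 / 2 \<le> lyap z" "lyap z \<le> lyap_gain / 2 * (norm z)^2"
proof -
  have "0 \<le> Phi i r" for i r
    using Phi_bounds(1)[where i = i and a = 0 and b = r] by (simp add: Phi_zero phi_zero)
  then have "0 \<le> (\<Sum>i\<in>UNIV. \<omega> $ i * Phi i (z $ i))"
    using weights_pos by (intro sum_nonneg mult_nonneg_nonneg) (auto intro: less_imp_le)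
  then show "(norm z)^2 / 2 \<le> lyap z"
    using lyap_weight_nonneg by (simp add: lyap_def)
  show "lyap z \<le> lyap_gain / 2 * (norm z)^2"
    using lyap_tangent_bounds(2)[of 0 z] by simp
qed

lemma continuous_lyap: "continuous_on UNIV lyap"
proof -
  have "continuous_on UNIV (Phi i)" for i
    using Phi_has_real_derivative by (meson DERIV_isCont continuous_at_imp_continuous_on)
  then have "continuous_on UNIV (\<lambda>z::real^'l. Phi i (z $ i))" for i
    by (rule continuous_on_compose2[OF _ continuous_on_component[OF continuous_on_id]]) auto
  then show ?thesis
    unfolding lyap_def by (intro continuous_intros) auto
qed

lemma norm_lyap_grad_le: "norm (lyap_grad z) \<le> lyap_gain * norm z"
proof -
  have "norm (lyap_grad z) \<le> norm z + lyap_weight * (onorm ((*v) (diag_mat \<omega>)) * norm (phi_vec z))"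
    unfolding lyap_grad_def using lyap_weight_nonneg
    by (intro order_trans[OF norm_triangle_ineq add_left_mono])
      (simp add: mult_left_mono onorm[OF matrix_vector_mul_bounded_linear])
  also have "\<dots> \<le> norm z + lyap_weight * (onorm ((*v) (diag_mat \<omega>)) * norm z)"
    using lyap_weight_nonneg onorm_pos_le[OF matrix_vector_mul_bounded_linear] norm_phi_vec_le
    by (intro add_left_mono mult_left_mono) auto
  finally show ?thesis by (simp add: lyap_gain_def algebra_simps)
qed

lemma lmi_cross_term: "(diag_mat \<omega> *v phi_vec z) \<bullet> drift z \<le> - lmi_margin * (norm (phi_vec z))^2"
proof -
  define f where "f = phi_vec z"
  \<comment> \<open>the sector condition lets \<open>\<phi>(z)\<close> replace \<open>z\<close> in the damping term\<close>
  have "(diag_mat \<omega> *v f) \<bullet> f \<le> (diag_mat \<omega> *v f) \<bullet> z"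
    unfolding inner_diag_mat using phi_vec_sector weights_pos
    by (intro sum_mono) (simp add: f_def power2_eq_square mult.assoc mult_left_mono less_imp_le)
  then have "(1/\<tau>) * ((diag_mat \<omega> *v f) \<bullet> f) \<le> (1/\<tau>) * ((diag_mat \<omega> *v f) \<bullet> z)"
    using tau_pos by (intro mult_left_mono) auto
  moreover have "(diag_mat \<omega> *v f) \<bullet> drift z
      = (diag_mat \<omega> *v f) \<bullet> (T *v f) - (1/\<tau>) * ((diag_mat \<omega> *v f) \<bullet> z)"
    by (simp add: drift_def f_def inner_diff_right)
  ultimately show ?thesis
    using lmi_margin(2)[of f] by (simp add: f_def inner_diff_right)
qed

lemma lyap_dissipation:
  "lyap_grad z \<bullet> (drift z + q) \<le> \<tau> * lyap_gain^2 * (norm q)^2 - (norm z)^2 / (4 * \<tau>)"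
proof -
  define f where "f = phi_vec z"
  define N where "N = onorm ((*v) T)"
  have weight: "lyap_weight * lmi_margin = \<tau> * N^2 / 2"
    using lmi_margin(1) by (simp add: N_def lyap_weight_def)
  have "lyap_weight * ((diag_mat \<omega> *v f) \<bullet> drift z) \<le> lyap_weight * (- lmi_margin * (norm f)^2)"
    using mult_left_mono[OF lmi_cross_term[of z] lyap_weight_nonneg] by (simp add: f_def)
  also have "\<dots> = - (lyap_weight * lmi_margin) * (norm f)^2" by (simp add: mult.assoc)
  finally have cross: "lyap_weight * ((diag_mat \<omega> *v f) \<bullet> drift z) \<le> - (\<tau> * N^2 / 2) * (norm f)^2"
    unfolding weight .
  have "z \<bullet> drift z = (T *v f) \<bullet> z - (norm z)^2 / \<tau>"
    by (simp add: drift_def f_def inner_diff_right inner_commute power2_norm_eq_inner)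
  then have own: "z \<bullet> drift z \<le> N * norm f * norm z - (norm z)^2 / \<tau>"
    using inner_matrix_vector_le_onorm[of T f z] by (simp add: N_def)
  have disturbance: "lyap_grad z \<bullet> q \<le> lyap_gain * norm z * norm q"
    using norm_cauchy_schwarz[of "lyap_grad z" q]
      mult_right_mono[OF norm_lyap_grad_le[of z] norm_ge_zero[of q]]
    by linarith
  have "lyap_grad z \<bullet> (drift z + q)
      = z \<bullet> drift z + lyap_weight * ((diag_mat \<omega> *v f) \<bullet> drift z) + lyap_grad z \<bullet> q"
    by (simp add: lyap_grad_def f_def inner_add_left inner_add_right)
  also have "\<dots> \<le> N * norm f * norm z - \<tau> * N^2 / 2 * (norm f)^2
                  + lyap_gain * norm z * norm q - (norm z)^2 / \<tau>"
    using own cross disturbance by linarith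
  also have "\<dots> \<le> \<tau> * lyap_gain^2 * (norm q)^2 - (norm z)^2 / (4 * \<tau>)"
    by (rule completing_squares_le[OF tau_pos])
  finally show ?thesis .
qed

lemma lyap_step_le:
  assumes "h \<ge> 0"
  shows "lyap (a + h *\<^sub>R (drift a + v))
           \<le> lyap a + h * (\<tau> * lyap_gain^2 * (norm v)^2 - (norm a)^2 / (4 * \<tau>))
              + lyap_gain / 2 * h^2 * (norm (drift a + v))^2"
proof -
  have "lyap (a + h *\<^sub>R (drift a + v))
      \<le> lyap a + h * (lyap_grad a \<bullet> (drift a + v)) + lyap_gain / 2 * h^2 * (norm (drift a + v))^2"
    using lyap_tangent_bounds(2)[of a "h *\<^sub>R (drift a + v)"] assms
    by (simp add: power2_eq_square mult_ac)
  then show ?thesis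
    using mult_left_mono[OF lyap_dissipation[of a v] assms] by linarith
qed

lemma lyap_sublevel_bounded: "bounded {z. lyap z \<le> R}"
  unfolding bounded_iff
proof (intro exI ballI)
  fix z assume "z \<in> {z. lyap z \<le> R}"
  then have "(norm z)^2 \<le> 2 * R" using lyap_bounds(1)[of z] by simp
  then show "norm z \<le> sqrt (2 * R)" by (rule real_le_rsqrt)
qed

lemma euler_step_descent:
  obtains h E where "0 < h" "h \<le> 1"
    "\<And>\<xi>. lyap (\<xi> + h *\<^sub>R (drift \<xi> + c)) \<le> lyap \<xi> + h * (E - (norm \<xi>)^2 / (8 * \<tau>))"
proof
  define G where "G = lyap_gain"
  define L where "L = 1/\<tau> + onorm ((*v) T)"
  define h where "h = 1 / (8 * \<tau> * G * L^2 + 1)"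
  have G: "G \<ge> 1" using lyap_gain_ge_1 by (simp add: G_def)
  have "8 * \<tau> * G * L^2 + 1 > 0" using tau_pos G by (simp add: add_nonneg_pos)
  then have "G * L^2 * h \<le> 1 / (8 * \<tau>)" using tau_pos G by (simp add: h_def field_simps)
  show h: "0 < h" "h \<le> 1"
    using \<open>8 * \<tau> * G * L^2 + 1 > 0\<close> tau_pos G by (auto simp: h_def field_simps)
  fix \<xi>
  have "(norm (drift \<xi> + c))^2 \<le> (L * norm \<xi> + norm c)^2"
    using norm_drift_le[of \<xi>] norm_triangle_ineq[of "drift \<xi>" c]
    by (intro power_mono) (auto simp: L_def)
  also have "\<dots> \<le> 2 * L^2 * (norm \<xi>)^2 + 2 * (norm c)^2"
    using zero_le_power2[of "L * norm \<xi> - norm c"] by (simp add: power2_eq_square algebra_simps)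
  finally have "G / 2 * h^2 * (norm (drift \<xi> + c))^2
      \<le> G / 2 * h^2 * (2 * L^2 * (norm \<xi>)^2 + 2 * (norm c)^2)"
    using G by (intro mult_left_mono) auto
  also have "\<dots> = h * ((G * L^2 * h) * (norm \<xi>)^2 + h * (G * (norm c)^2))"
    by (simp add: power2_eq_square algebra_simps)
  also have "\<dots> \<le> h * ((norm \<xi>)^2 / (8 * \<tau>) + 1 * (G * (norm c)^2))"
    using mult_right_mono[OF \<open>G * L^2 * h \<le> 1 / (8 * \<tau>)\<close> zero_le_power2[of "norm \<xi>"]] h G
    by (intro mult_left_mono add_mono mult_right_mono) auto
  finally have "G / 2 * h^2 * (norm (drift \<xi> + c))^2 \<le> h * ((norm \<xi>)^2 / (8 * \<tau>) + G * (norm c)^2)"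
    by simp
  with lyap_step_le[of h \<xi> c] h
  show "lyap (\<xi> + h *\<^sub>R (drift \<xi> + c))
      \<le> lyap \<xi> + h * (\<tau> * G^2 * (norm c)^2 + G * (norm c)^2 - (norm \<xi>)^2 / (8 * \<tau>))"
    by (simp add: G_def field_simps)
qed

lemma euler_step_sublevel:
  obtains h R0 where "h > 0" "\<And>\<xi>. lyap (\<xi> + h *\<^sub>R (drift \<xi> + c)) \<le> max (lyap \<xi>) R0"
proof -
  obtain h E where h: "0 < h" "h \<le> 1"
    and descent: "\<And>\<xi>. lyap (\<xi> + h *\<^sub>R (drift \<xi> + c)) \<le> lyap \<xi> + h * (E - (norm \<xi>)^2 / (8 * \<tau>))"
    by (rule euler_step_descent[where c = c]) blast
  have "lyap (\<xi> + h *\<^sub>R (drift \<xi> + c)) \<le> max (lyap \<xi>) (4 * \<tau> * lyap_gain * E + E)" for \<xi>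
  proof (cases "E \<le> (norm \<xi>)^2 / (8 * \<tau>)")
    case True
    then have "h * (E - (norm \<xi>)^2 / (8 * \<tau>)) \<le> 0"
      using h by (intro mult_nonneg_nonpos) auto
    then show ?thesis using descent[of \<xi>] by (simp add: le_max_iff_disj)
  next
    case False
    then have "(norm \<xi>)^2 \<le> 8 * \<tau> * E" using tau_pos by (simp add: field_simps)
    then have "lyap_gain / 2 * (norm \<xi>)^2 \<le> lyap_gain / 2 * (8 * \<tau> * E)"
      using lyap_gain_ge_1 by (intro mult_left_mono) auto
    with lyap_bounds(2)[of \<xi>] have "lyap \<xi> \<le> lyap_gain / 2 * (8 * \<tau> * E)" by linarith
    also have "\<dots> = 4 * \<tau> * lyap_gain * E" by simp
    finally have "lyap \<xi> \<le> 4 * \<tau> * lyap_gain * E" .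
    moreover have "h * (E - (norm \<xi>)^2 / (8 * \<tau>)) \<le> 1 * E"
      using h False tau_pos by (intro mult_mono) auto
    ultimately show ?thesis using descent[of \<xi>] by (simp add: le_max_iff_disj)
  qed
  then show ?thesis using h(1) that by blast
qed

lemma convex_lyap_sublevel: "convex {z. lyap z \<le> R}"
  by (rule convex_sublevel_if_tangent_minorant[where g = lyap_grad]) (rule lyap_tangent_bounds(1))

lemma drift_plus_const_has_zero: obtains \<xi> where "drift \<xi> + c = 0"
proof -
  obtain h R0 where "h > 0" and invariant: "\<And>\<xi>. lyap (\<xi> + h *\<^sub>R (drift \<xi> + c)) \<le> max (lyap \<xi>) R0"
    by (rule euler_step_sublevel[where c = c]) blast
  have "continuous_on UNIV (\<lambda>\<xi>. \<xi> + h *\<^sub>R (drift \<xi> + c))"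
    by (intro continuous_intros continuous_drift)
  then obtain \<xi> where "\<xi> + h *\<^sub>R (drift \<xi> + c) = \<xi>"
    using fixed_point_if_sublevel_invariant[where V = lyap and P = "\<lambda>\<xi>. \<xi> + h *\<^sub>R (drift \<xi> + c)"]
      continuous_lyap convex_lyap_sublevel lyap_sublevel_bounded invariant
    by blast
  then show ?thesis using \<open>h > 0\<close> that by simp
qed

lemma lyap_step_bound:
  assumes "h \<ge> 0" "norm v \<le> B"
  shows "lyap (a + h *\<^sub>R (drift a + v))
           \<le> lyap a + h * (\<tau> * lyap_gain^2 * B^2 - lyap a / (2 * \<tau> * lyap_gain))
              + h^2 * (lyap_gain / 2 * ((1/\<tau> + onorm ((*v) T)) * norm a + B)^2)"
proof -
  have "\<tau> * lyap_gain^2 * (norm v)^2 \<le> \<tau> * lyap_gain^2 * B^2"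
    using assms tau_pos by (intro mult_left_mono power_mono) auto
  moreover have "lyap a / (2 * \<tau> * lyap_gain) \<le> (norm a)^2 / (4 * \<tau>)"
    using lyap_bounds(2)[of a] tau_pos lyap_gain_ge_1 by (simp add: field_simps)
  ultimately have "h * (\<tau> * lyap_gain^2 * (norm v)^2 - (norm a)^2 / (4 * \<tau>))
      \<le> h * (\<tau> * lyap_gain^2 * B^2 - lyap a / (2 * \<tau> * lyap_gain))"
    using assms(1) by (intro mult_left_mono) auto
  moreover have "norm (drift a + v) \<le> (1/\<tau> + onorm ((*v) T)) * norm a + B"
    using norm_drift_le[of a] norm_triangle_ineq[of "drift a" v] assms(2) by simp
  then have "lyap_gain / 2 * h^2 * (norm (drift a + v))^2
      \<le> h^2 * (lyap_gain / 2 * ((1/\<tau> + onorm ((*v) T)) * norm a + B)^2)"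
    using lyap_gain_ge_1 by (simp add: mult_left_mono power_mono mult_ac)
  ultimately show ?thesis using lyap_step_le[OF assms(1), of a v] by linarith
qed

lemma lyap_dini_along_solution:
  assumes sol: "caratheodory_solution (\<lambda>z v. drift z + v) y q"
    and q: "\<And>s. s \<ge> 0 \<Longrightarrow> norm (q s) \<le> Q" and "t \<ge> 0" and "e > 0"
  shows "\<exists>\<delta>>0. \<forall>h. 0 < h \<and> h < \<delta> \<longrightarrow>
           lyap (y (t + h))
             \<le> lyap (y t) + h * (\<tau> * lyap_gain^2 * Q^2 - lyap (y t) / (2 * \<tau> * lyap_gain) + e)"
proof -
  define G where "G = lyap_gain"
  define a where "a = y t"
  have "Q \<ge> 0" using q[of 0] norm_ge_zero[of "q 0"] by linarith
  then obtain \<epsilon> where "\<epsilon> > 0" "\<epsilon> \<le> 1"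
    and disturbance: "\<tau> * G^2 * (Q + \<epsilon>)^2 \<le> \<tau> * G^2 * Q^2 + e / 2"
    using square_perturbation_le[of "\<tau> * G^2" Q "e / 2"] tau_pos \<open>e > 0\<close> by auto
  obtain \<delta> where "\<delta> > 0" and increment:
    "\<And>h. 0 < h \<Longrightarrow> h < \<delta> \<Longrightarrow> \<exists>v. y (t + h) = a + h *\<^sub>R (drift a + v) \<and> norm v \<le> Q + \<epsilon>"
    using caratheodory_solution_increment[OF sol continuous_drift q \<open>t \<ge> 0\<close> \<open>\<epsilon> > 0\<close>]
    unfolding a_def by blast
  define K where "K = G / 2 * ((1/\<tau> + onorm ((*v) T)) * norm a + (Q + \<epsilon>))^2"
  have "K \<ge> 0" using lyap_gain_ge_1 by (simp add: K_def G_def)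
  define \<delta>' where "\<delta>' = min \<delta> (e / (2 * K + 1))"
  have "lyap (y (t + h)) \<le> lyap a + h * (\<tau> * G^2 * Q^2 - lyap a / (2 * \<tau> * G) + e)"
    if h: "0 < h" "h < \<delta>'" for h
  proof -
    obtain v where y: "y (t + h) = a + h *\<^sub>R (drift a + v)" and v: "norm v \<le> Q + \<epsilon>"
      using increment h by (auto simp: \<delta>'_def)
    have "h * (2 * K + 1) \<le> e"
      using h \<open>K \<ge> 0\<close> by (simp add: \<delta>'_def pos_less_divide_eq add_nonneg_pos less_imp_le)
    then have "h^2 * K \<le> h * (e / 2)"
      using h by (simp add: power2_eq_square algebra_simps)
    moreover have "h * (\<tau> * G^2 * (Q + \<epsilon>)^2) \<le> h * (\<tau> * G^2 * Q^2 + e / 2)"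
      using disturbance h by (intro mult_left_mono) auto
    ultimately show ?thesis
      using lyap_step_bound[of h v "Q + \<epsilon>" a] h v unfolding y G_def K_def
      by (simp add: algebra_simps)
  qed
  moreover have "\<delta>' > 0" using \<open>\<delta> > 0\<close> \<open>e > 0\<close> \<open>K \<ge> 0\<close> by (simp add: \<delta>'_def add_nonneg_pos)
  ultimately show ?thesis unfolding a_def G_def by blast
qed

lemma lyap_along_solution_le:
  assumes sol: "caratheodory_solution (\<lambda>z v. drift z + v) y q"
    and q: "\<And>s. s \<ge> 0 \<Longrightarrow> norm (q s) \<le> Q" and "t \<ge> 0"
  shows "lyap (y t) \<le> 2 * \<tau>^2 * lyap_gain^3 * Q^2 + exp (- t / (2 * \<tau> * lyap_gain)) * lyap (y 0)"
proof -
  define k where "k = 1 / (2 * \<tau> * lyap_gain)"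
  define E where "E = \<tau> * lyap_gain^2 * Q^2"
  have "k > 0" using tau_pos lyap_gain_ge_1 by (simp add: k_def)
  have E_k: "E / k = 2 * \<tau>^2 * lyap_gain^3 * Q^2"
    using tau_pos lyap_gain_ge_1 by (simp add: E_def k_def power2_eq_square power3_eq_cube)
  have "lyap (y t) \<le> E / k + exp (- k * t) * (lyap (y 0) - E / k)"
  proof (rule dini_comparison_exp[where w = "\<lambda>s. lyap (y s)", OF \<open>k > 0\<close> _ _ \<open>t \<ge> 0\<close>])
    show "continuous_on {0..} (\<lambda>s. lyap (y s))"
      using sol
      by (auto simp: caratheodory_solution_def intro: continuous_on_compose2[OF continuous_lyap])
    fix s e :: real assume "s \<ge> 0" "e > 0"
    then show "\<exists>\<delta>>0. \<forall>h. 0 < h \<and> h < \<delta> \<longrightarrow>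
        lyap (y (s + h)) \<le> lyap (y s) + h * (E - k * lyap (y s) + e)"
      using lyap_dini_along_solution[OF sol q] by (simp add: E_def k_def)
  qed
  moreover have "0 \<le> exp (- k * t) * (E / k)"
    using \<open>k > 0\<close> tau_pos by (simp add: E_def)
  moreover have "exp (- k * t) * (lyap (y 0) - E / k)
      = exp (- k * t) * lyap (y 0) - exp (- k * t) * (E / k)"
    by (rule right_diff_distrib)
  ultimately have "lyap (y t) \<le> E / k + exp (- k * t) * lyap (y 0)" by linarith
  then show ?thesis unfolding E_k by (simp add: k_def)
qed

theorem exponential_iss:
  obtains C c D where "C > 0" "c > 0" "D > 0"
    "\<And>y q Q t. caratheodory_solution (\<lambda>z v. drift z + v) y q \<Longrightarrow> (\<And>s. s \<ge> 0 \<Longrightarrow> norm (q s) \<le> Q) \<Longrightarrow>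
       t \<ge> 0 \<Longrightarrow> norm (y t) \<le> C * exp (- c * t) * norm (y 0) + D * Q"
proof
  define G where "G = lyap_gain"
  have G: "G \<ge> 1" using lyap_gain_ge_1 by (simp add: G_def)
  show "sqrt G > 0" "1 / (4 * \<tau> * G) > 0" "2 * \<tau> * G * sqrt G > 0"
    using G tau_pos by auto
  fix y q Q and t :: real
  assume sol: "caratheodory_solution (\<lambda>z v. drift z + v) y q"
    and q: "\<And>s. s \<ge> 0 \<Longrightarrow> norm (q s) \<le> Q" and "t \<ge> 0"
  define decay where "decay = exp (- (1 / (4 * \<tau> * G)) * t)"
  have "Q \<ge> 0" using q[of 0] norm_ge_zero[of "q 0"] by linarith
  have "exp (- t / (2 * \<tau> * G)) = decay^2"
    by (simp add: decay_def power2_eq_square field_simps flip: exp_add)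
  then have "(norm (y t))^2 \<le> 4 * \<tau>^2 * G^3 * Q^2 + decay^2 * (G * (norm (y 0))^2)"
    using lyap_bounds(1)[of "y t"] lyap_bounds(2)[of "y 0"] lyap_along_solution_le[OF sol q \<open>t \<ge> 0\<close>]
      mult_left_mono[of "lyap (y 0)" "G / 2 * (norm (y 0))^2" "decay^2"]
    by (simp add: G_def)
  also have "\<dots> = (sqrt G * decay * norm (y 0))^2 + (2 * \<tau> * G * sqrt G * Q)^2"
    using G
    by (simp add: power_mult_distrib power3_eq_cube power2_eq_square[of \<tau>] power2_eq_square[of G])
  finally show
    "norm (y t) \<le> sqrt G * exp (- (1 / (4 * \<tau> * G)) * t) * norm (y 0) + 2 * \<tau> * G * sqrt G * Q"
    unfolding decay_def[symmetric]
    by (rule le_add_if_square_le_sum_squares) (use G tau_pos \<open>Q \<ge> 0\<close> in \<open>auto simp: decay_def\<close>)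
qed

end

section \<open>Input-to-state stability of the CRNN\<close>

lemma class_KL_exponential:
  assumes "C > 0" "c > 0"
  shows "class_KL (\<lambda>r t. C * exp (- c * t) * r)"
  unfolding class_KL_def class_K_def
proof (intro conjI allI impI)
  fix t :: real
  show "continuous_on {0..} (\<lambda>r. C * exp (- c * t) * r)" by (intro continuous_intros)
  show "C * exp (- c * t) * 0 = 0" by simp
  show "strict_mono_on {0..} (\<lambda>r. C * exp (- c * t) * r)"
    using assms by (intro strict_mono_onI) simp
next
  fix r :: real assume "r \<ge> 0"
  show "antimono_on {0..} (\<lambda>t. C * exp (- c * t) * r)"
    using assms \<open>r \<ge> 0\<close> by (intro monotone_onI) (simp add: mult_right_mono)
  have "((\<lambda>t. exp (- c * t)) \<longlongrightarrow> 0) at_top"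
    using assms(2) by real_asymp
  then have "((\<lambda>t. C * exp (- c * t) * r) \<longlongrightarrow> C * 0 * r) at_top"
    by (intro tendsto_intros)
  then show "((\<lambda>t. C * exp (- c * t) * r) \<longlongrightarrow> 0) at_top" by simp
qed

lemma class_K_inf_linear:
  assumes "D > 0"
  shows "class_K_inf (\<lambda>s. D * s)"
  unfolding class_K_inf_def class_K_def
proof (intro conjI)
  show "continuous_on {0..} (\<lambda>s. D * s)" by (intro continuous_intros)
  show "strict_mono_on {0..} (\<lambda>s. D * s)" using assms by (intro strict_mono_onI) simp
  show "filterlim (\<lambda>s. D * s) at_top at_top"
    using assms by (intro filterlim_tendsto_pos_mult_at_top[OF tendsto_const _ filterlim_ident])
qed simp

lemma norm_le_Sup_norm:
  assumes "bounded (u ` S)" "s \<in> S"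
  shows "norm (u s) \<le> Sup ((\<lambda>s. norm (u s)) ` S)"
proof (rule cSup_upper)
  obtain B where "\<And>s. s \<in> S \<Longrightarrow> norm (u s) \<le> B" using assms(1) by (auto simp: bounded_iff)
  then show "bdd_above ((\<lambda>s. norm (u s)) ` S)" by (rule bdd_aboveI2)
qed (use assms(2) in simp)

lemma ISS_if_exponential_estimate:
  fixes f :: "real^'n \<Rightarrow> real^'m \<Rightarrow> real^'n"
  assumes "f xe 0 = 0" and "C > 0" "c > 0" "D > 0"
    and estimate: "\<And>x u t. bounded (u ` {0..}) \<Longrightarrow> caratheodory_solution f x u \<Longrightarrow> t \<ge> 0 \<Longrightarrow>
       norm (x t - xe) \<le> C * exp (- c * t) * norm (x 0 - xe) + D * Sup ((\<lambda>s. norm (u s)) ` {0..})"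
  shows "ISS f"
  unfolding ISS_def
proof (intro exI conjI allI impI)
  show "f xe 0 = 0" by fact
  show "class_KL (\<lambda>r t. C * exp (- c * t) * r)" using assms(2,3) by (rule class_KL_exponential)
  show "class_K_inf (\<lambda>s. D * s)" using assms(4) by (rule class_K_inf_linear)
qed (use estimate in \<open>auto simp: caratheodory_solution_def\<close>)

lemma sigma_vec_lipschitz:
  assumes "slope_restricted \<sigma>"
  shows "norm (sigma_vec \<sigma> a - sigma_vec \<sigma> b) \<le> norm (a - b)"
  by (rule norm_le_componentwise_cart)
    (simp add: sigma_vec_def slope_restricted_lipschitz[OF assms])

lemma crnn_lure_system:
  fixes W :: "real^'l^'n" and A :: "real^'n^'l"
  assumes "\<tau> > 0" "slope_restricted \<sigma>" "\<And>i. \<omega> $ i > 0"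
    and "neg_definite (diag_mat \<omega> ** (A ** W - (1/\<tau>) *\<^sub>R mat 1)
                      + (transpose W ** transpose A - (1/\<tau>) *\<^sub>R mat 1) ** diag_mat \<omega>)"
  shows "lure_system \<tau> (A ** W) \<omega> (\<lambda>i r. \<sigma> (r + p $ i) - \<sigma> (p $ i))"
  using assms by unfold_locales (simp_all add: slope_restricted_shift matrix_transpose_mul)

lemma drift_shifted_sigma:
  assumes "lure_system \<tau> T \<omega> (\<lambda>i r. \<sigma> (r + p $ i) - \<sigma> (p $ i))"
  shows "lure_system.drift \<tau> T (\<lambda>i r. \<sigma> (r + p $ i) - \<sigma> (p $ i)) z
     = - (1/\<tau>) *\<^sub>R z + T *v (sigma_vec \<sigma> (z + p) - sigma_vec \<sigma> p)"
proof -
  have "lure_system.phi_vec (\<lambda>i r. \<sigma> (r + p $ i) - \<sigma> (p $ i)) z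
      = sigma_vec \<sigma> (z + p) - sigma_vec \<sigma> p"
    using assms by (simp add: lure_system.phi_vec_def sigma_vec_def vec_eq_iff)
  then show ?thesis using assms by (simp add: lure_system.drift_def)
qed

lemma crnn_equilibrium_exists:
  assumes "lure_system \<tau> (A ** W) \<omega> (\<lambda>i r. \<sigma> (r + \<mu> $ i) - \<sigma> (\<mu> $ i))"
  obtains xe where "crnn \<tau> W A B \<mu> \<nu> \<sigma> xe 0 = 0"
proof -
  interpret lure_system \<tau> "A ** W" \<omega> "\<lambda>i r. \<sigma> (r + \<mu> $ i) - \<sigma> (\<mu> $ i)" by fact
  obtain \<xi> where "drift \<xi> + ((A ** W) *v sigma_vec \<sigma> \<mu> + A *v \<nu>) = 0"
    by (rule drift_plus_const_has_zero)
  then have \<xi>: "(1/\<tau>) *\<^sub>R \<xi> = A *v (W *v sigma_vec \<sigma> (\<xi> + \<mu>) + \<nu>)"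
    by (simp add: drift_shifted_sigma[OF assms] matrix_vector_mul_assoc[symmetric] algebra_simps)
  define xe where "xe = \<tau> *\<^sub>R (W *v sigma_vec \<sigma> (\<xi> + \<mu>) + \<nu>)"
  have "A *v xe = \<xi>"
    using \<xi> tau_pos by (simp add: xe_def matrix_vector_mult_scaleR flip: \<xi>)
  then have "crnn \<tau> W A B \<mu> \<nu> \<sigma> xe 0 = 0"
    using tau_pos by (simp add: crnn_def xe_def)
  then show ?thesis by (rule that)
qed

lemma crnn_error_dynamics:
  assumes "crnn \<tau> W A B \<mu> \<nu> \<sigma> xe 0 = 0"
  shows "A *v crnn \<tau> W A B \<mu> \<nu> \<sigma> x u
    = - (1/\<tau>) *\<^sub>R (A *v x - A *v xe)
      + (A ** W) *v (sigma_vec \<sigma> (A *v x + \<mu>) - sigma_vec \<sigma> (A *v xe + \<mu>))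
      + (A ** W) *v (sigma_vec \<sigma> (A *v x + B *v u + \<mu>) - sigma_vec \<sigma> (A *v x + \<mu>))"
proof -
  have \<nu>: "\<nu> = (1/\<tau>) *\<^sub>R xe - W *v sigma_vec \<sigma> (A *v xe + \<mu>)"
    using assms by (simp add: crnn_def algebra_simps)
  show ?thesis
    unfolding crnn_def \<nu> by (simp add: matrix_vector_mul_assoc[symmetric] algebra_simps)
qed

lemma crnn_error_solution:
  assumes lure: "lure_system \<tau> (A ** W) \<omega> (\<lambda>i r. \<sigma> (r + (A *v xe + \<mu>) $ i) - \<sigma> ((A *v xe + \<mu>) $ i))"
    and xe: "crnn \<tau> W A B \<mu> \<nu> \<sigma> xe 0 = 0" and sol: "caratheodory_solution (crnn \<tau> W A B \<mu> \<nu> \<sigma>) x u"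
  shows "caratheodory_solution
           (\<lambda>z v. lure_system.drift \<tau> (A ** W)
              (\<lambda>i r. \<sigma> (r + (A *v xe + \<mu>) $ i) - \<sigma> ((A *v xe + \<mu>) $ i)) z + v)
           (\<lambda>s. A *v x s + - (A *v xe))
           (\<lambda>s. (A ** W) *v (sigma_vec \<sigma> (A *v x s + B *v u s + \<mu>) - sigma_vec \<sigma> (A *v x s + \<mu>)))"
  by (rule caratheodory_solution_affine_image[OF sol matrix_vector_mul_bounded_linear])
    (unfold drift_shifted_sigma[OF lure] crnn_error_dynamics[OF xe], simp add: algebra_simps)

lemma crnn_exponential_estimate:
  fixes W :: "real^'l^'n" and A :: "real^'n^'l" and B :: "real^'m^'l"
  assumes lure: "lure_system \<tau> (A ** W) \<omega> (\<lambda>i r. \<sigma> (r + (A *v xe + \<mu>) $ i) - \<sigma> ((A *v xe + \<mu>) $ i))"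
    and xe: "crnn \<tau> W A B \<mu> \<nu> \<sigma> xe 0 = 0"
    and slope: "slope_restricted \<sigma>" and rank: "rank A = CARD('n)"
  obtains C c D where "C > 0" "c > 0" "D > 0"
    "\<And>x u t. bounded (u ` {0..}) \<Longrightarrow> caratheodory_solution (crnn \<tau> W A B \<mu> \<nu> \<sigma>) x u \<Longrightarrow> t \<ge> 0 \<Longrightarrow>
       norm (x t - xe) \<le> C * exp (- c * t) * norm (x 0 - xe) + D * Sup ((\<lambda>s. norm (u s)) ` {0..})"
proof -
  interpret lure_system \<tau> "A ** W" \<omega> "\<lambda>i r. \<sigma> (r + (A *v xe + \<mu>) $ i) - \<sigma> ((A *v xe + \<mu>) $ i)"
    by (fact lure)
  obtain C0 c D0 where "C0 > 0" "c > 0" "D0 > 0" and iss: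
    "\<And>y q Q t. caratheodory_solution (\<lambda>z v. drift z + v) y q \<Longrightarrow> (\<And>s. s \<ge> 0 \<Longrightarrow> norm (q s) \<le> Q) \<Longrightarrow>
       t \<ge> 0 \<Longrightarrow> norm (y t) \<le> C0 * exp (- c * t) * norm (y 0) + D0 * Q"
    by (rule exponential_iss) blast
  obtain \<kappa> where "\<kappa> > 0" and \<kappa>: "\<And>v. \<kappa> * norm v \<le> norm (A *v v)"
    using injective_imp_isometric[of UNIV "(*v) A"] rank
    by (auto simp: full_rank_injective inj_on_def matrix_vector_mult_0_right)
  obtain NA where "NA > 0" and NA: "\<And>v. norm (A *v v) \<le> norm v * NA"
    using bounded_linear.pos_bounded[OF matrix_vector_mul_bounded_linear] by blast
  obtain NT where "NT > 0" and NT: "\<And>v. norm ((A ** W) *v v) \<le> norm v * NT"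
    using bounded_linear.pos_bounded[OF matrix_vector_mul_bounded_linear] by blast
  obtain NB where "NB > 0" and NB: "\<And>v. norm (B *v v) \<le> norm v * NB"
    using bounded_linear.pos_bounded[OF matrix_vector_mul_bounded_linear] by blast
  show ?thesis
  proof (rule that[of "C0 * NA / \<kappa>" c "D0 * NT * NB / \<kappa>"])
    show "C0 * NA / \<kappa> > 0" "c > 0" "D0 * NT * NB / \<kappa> > 0"
      using \<open>C0 > 0\<close> \<open>NA > 0\<close> \<open>\<kappa> > 0\<close> \<open>c > 0\<close> \<open>D0 > 0\<close> \<open>NT > 0\<close> \<open>NB > 0\<close> by auto
    fix x u and t :: real
    assume bounded: "bounded (u ` {0..})" and sol: "caratheodory_solution (crnn \<tau> W A B \<mu> \<nu> \<sigma>) x u"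
      and "t \<ge> 0"
    define U where "U = Sup ((\<lambda>s. norm (u s)) ` {0..})"
    define q where
      "q s = (A ** W) *v (sigma_vec \<sigma> (A *v x s + B *v u s + \<mu>) - sigma_vec \<sigma> (A *v x s + \<mu>))" for s
    have y: "caratheodory_solution (\<lambda>z v. drift z + v) (\<lambda>s. A *v x s + - (A *v xe)) q"
      unfolding q_def by (rule crnn_error_solution[OF lure xe sol])
    have q: "norm (q s) \<le> NT * NB * U" if "s \<ge> 0" for s
    proof -
      have "norm (q s) \<le> norm (B *v u s) * NT"
        using NT sigma_vec_lipschitz[OF slope, of "A *v x s + B *v u s + \<mu>" "A *v x s + \<mu>"]
        by (simp add: q_def) (meson \<open>NT > 0\<close> less_imp_le mult_right_mono order_trans)
      also have "\<dots> \<le> norm (u s) * NB * NT"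
        using NB \<open>NT > 0\<close> by (simp add: mult_right_mono)
      also have "\<dots> \<le> U * NB * NT"
        using norm_le_Sup_norm[OF bounded, of s] that \<open>NB > 0\<close> \<open>NT > 0\<close> by (simp add: U_def)
      finally show ?thesis by (simp add: mult_ac)
    qed
    from iss[OF y q \<open>t \<ge> 0\<close>]
    have "norm (A *v (x t - xe)) \<le> C0 * exp (- c * t) * norm (A *v (x 0 - xe)) + D0 * (NT * NB * U)"
      by (simp add: matrix_vector_mult_diff_distrib)
    also have "\<dots> \<le> C0 * exp (- c * t) * (NA * norm (x 0 - xe)) + D0 * (NT * NB * U)"
      using NA[of "x 0 - xe"] \<open>C0 > 0\<close> by (simp add: mult_ac)
    finally have
      "\<kappa> * norm (x t - xe) \<le> C0 * exp (- c * t) * (NA * norm (x 0 - xe)) + D0 * (NT * NB * U)"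
      using \<kappa>[of "x t - xe"] by linarith
    then show
      "norm (x t - xe) \<le> C0 * NA / \<kappa> * exp (- c * t) * norm (x 0 - xe) + D0 * NT * NB / \<kappa> * U"
      using \<open>\<kappa> > 0\<close> by (simp add: field_simps)
  qed
qed

theorem proposition4:
  fixes \<tau> :: real and W :: "real^'l^'n" and A :: "real^'n^'l" and B :: "real^'m^'l"
    and \<mu> :: "real^'l" and \<nu> :: "real^'n" and \<sigma> :: "real \<Rightarrow> real" and \<omega> :: "real^'l"
  assumes "CARD('n) \<le> CARD('l)"
    and "\<tau> > 0"
    and "strict_mono \<sigma>" and "continuous_on UNIV \<sigma>" and "\<sigma> 0 = 0"
    and "\<And>r r'. r \<noteq> r' \<Longrightarrow> 0 \<le> (\<sigma> r - \<sigma> r') / (r - r') \<and> (\<sigma> r - \<sigma> r') / (r - r') \<le> 1"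
    and "rank A = CARD('n)"
    and "\<And>i. \<omega> $ i > 0"
    and "neg_definite (diag_mat \<omega> ** (A ** W - (1/\<tau>) *\<^sub>R mat 1)
                      + (transpose W ** transpose A - (1/\<tau>) *\<^sub>R mat 1) ** diag_mat \<omega>)"
  shows "ISS (crnn \<tau> W A B \<mu> \<nu> \<sigma>)"
proof -
  \<comment> \<open>\<open>CARD('n) \<le> CARD('l)\<close> follows from the rank condition, continuity of \<open>\<sigma>\<close> from the slope
    condition.\<close>
  have slope: "slope_restricted \<sigma>"
    using assms(6) by (rule slope_restricted_if_difference_quotient)
  have lure: "\<And>p. lure_system \<tau> (A ** W) \<omega> (\<lambda>i r. \<sigma> (r + p $ i) - \<sigma> (p $ i))"
    using assms(2) slope assms(8,9) by (rule crnn_lure_system)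
  obtain xe where xe: "crnn \<tau> W A B \<mu> \<nu> \<sigma> xe 0 = 0"
    using crnn_equilibrium_exists[OF lure] by blast
  obtain C c D where "C > 0" "c > 0" "D > 0" and estimate:
    "\<And>x u t. bounded (u ` {0..}) \<Longrightarrow> caratheodory_solution (crnn \<tau> W A B \<mu> \<nu> \<sigma>) x u \<Longrightarrow> t \<ge> 0 \<Longrightarrow>
       norm (x t - xe) \<le> C * exp (- c * t) * norm (x 0 - xe) + D * Sup ((\<lambda>s. norm (u s)) ` {0..})"
    using crnn_exponential_estimate[OF lure xe slope assms(7)] by blast
  show ?thesis
    by (rule ISS_if_exponential_estimate[where f = "crnn \<tau> W A B \<mu> \<nu> \<sigma>",
          OF xe \<open>C > 0\<close> \<open>c > 0\<close> \<open>D > 0\<close> estimate])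
qed

end
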